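(* Let $\gamma=(g_1,g_2)\in \mathrm{Isom}(\mathbb{H}^2_{\mathbb{C}}\times\mathbb{H}^2_{\mathbb{C}})$, acting by $\gamma(x_1,x_2)=(g_1(x_1),g_2(x_2))$, where $g_1$ and $g_2$ are loxodromic isometries of $\mathbb{H}^2_{\mathbb{C}}$. Let $z_1,z_2\in\mathbb{H}^2_{\mathbb{C}}$ be points lying on the invariant axes of $g_1$ and $g_2$, respectively, and set $z=(z_1,z_2)$. Then the bisectors $E(z,\gamma(z))$ and $E(z,\gamma^{-1}(z))$ correspond to two faces of the Dirichlet domain $D(z)$ for the action of $\langle\gamma\rangle$ on $\mathbb{H}^2_{\mathbb{C}}\times\mathbb{H}^2_{\mathbb{C}}$.
   Context: $\mathbb{C}^{2,1}$ is $\mathbb{C}^3$ with the Hermitian form $\langle \mathbf z,\mathbf w\rangle=z_0\bar w_0+z_1\bar w_1-z_2\bar w_2$. The complex hyperbolic plane is $\mathbb{H}^2_{\mathbb{C}}=\{[\mathbf z]\in\mathbb{P}(\mathbb{C}^{2,1}):\langle\mathbf z,\mathbf z\rangle<0\}$ with the distance $d_{\mathbb{H}^2_{\mathbb{C}}}$ given by $\cosh^2\big(d_{\mathbb{H}^2_{\mathbb{C}}}(z,w)/2\big)=\frac{\langle\mathbf z,\mathbf w\rangle\langle\mathbf w,\mathbf z\rangle}{\langle\mathbf z,\mathbf z\rangle\langle\mathbf w,\mathbf w\rangle}$, where $\mathbf z,\mathbf w$ are lifts of $z,w$. Its boundary $\partial\mathbb{H}^2_{\mathbb{C}}$ is the set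 of projectivized nonzero null vectors. The product $\mathbb{H}^2_{\mathbb{C}}\times\mathbb{H}^2_{\mathbb{C}}$ carries the product metric $\rho((z_1,z_2),(w_1,w_2))=\sqrt{d_{\mathbb{H}^2_{\mathbb{C}}}(z_1,w_1)^2+d_{\mathbb{H}^2_{\mathbb{C}}}(z_2,w_2)^2}$. The group of holomorphic isometries of $\mathbb{H}^2_{\mathbb{C}}$ is $\mathrm{PU}(2,1)$. An element $g\in\mathrm{PU}(2,1)$ is loxodromic if it fixes exactly two points of $\partial\mathbb{H}^2_{\mathbb{C}}$ and no point of $\mathbb{H}^2_{\mathbb{C}}$; its invariant axis is the unique geodesic of $\mathbb{H}^2_{\mathbb{C}}$ joining its two boundary fixed points. For distinct points $z,w\in\mathbb{H}^2_{\mathbb{C}}\times\mathbb{H}^2_{\mathbb{C}}$, the bisector (equidistant hypersurface) is $E(z,w)=\{x\in\mathbb{H}^2_{\mathbb{C}}\times\mathbb{H}^2_{\mathbb{C}}:\rho(x,z)=\rho(x,w)\}$. The Dirichlet domain of $\langle\gamma\rangle$ with base point $z$ is $D(z)=\{x\in\mathbb{H}^2_{\mathbb{C}}\times\mathbb{H}^2_{\mathbb{C}}:\rho(x,z)\le\rho(g(x),z)\ \text{for all } g\in\langle\gamma\rangle\setminus\{1\}\}$. For $g\in\langle\gamma\rangle\setminus\{1\}$, the bisector $E(z,g(z))$ is said to correspond to a face of $D(z)$ if $D(z)\cap E(z,g(z))$ has non-empty interior relative to $E(z,g(z))$, this intersection being the face; "two faces" means that the faces given by the two bisectors are distinct. 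*)

theory Defs
  imports "HOL-Analysis.Analysis"
begin

section \<open>The Hermitian space and its projectivization\<close>

text \<open>The type \<^typ>\<open>3\<close> is indexed by 1, 2, 3, so the coordinates called z0, z1, z2 on
  paper are the components 1, 2, 3 here.\<close>

definition herm :: "complex^3 \<Rightarrow> complex^3 \<Rightarrow> complex" where
  "herm z w = z $ 1 * cnj (w $ 1) + z $ 2 * cnj (w $ 2) - z $ 3 * cnj (w $ 3)"

definition proj_rel :: "complex^3 \<Rightarrow> complex^3 \<Rightarrow> bool" where
  "proj_rel z w \<longleftrightarrow> z \<noteq> 0 \<and> w \<noteq> 0 \<and> (\<exists>c. w = c *s z)"

lemma proj_rel_refl: "z \<noteq> 0 \<Longrightarrow> proj_rel z z"
  by (auto simp: proj_rel_def intro: exI[of _ 1])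

lemma part_equivp_proj_rel: "part_equivp proj_rel"
proof (rule part_equivpI)
  have "proj_rel (vec 1) (vec 1)"
    unfolding proj_rel_def by (metis vec_eq_iff vec_component vector_smult_lid zero_index zero_neq_one)
  then show "\<exists>x. proj_rel x x" by blast
  show "symp proj_rel"
  proof (rule sympI)
    fix z w assume "proj_rel z w"
    then obtain c where c: "z \<noteq> 0" "w \<noteq> 0" "w = c *s z" by (auto simp: proj_rel_def)
    then have "c \<noteq> 0" by auto
    then have "z = (1 / c) *s w" using c by (simp add: vector_smult_assoc)
    then show "proj_rel w z" using c unfolding proj_rel_def by blast
  qed
  show "transp proj_rel"
    by (rule transpI) (auto simp: proj_rel_def vector_smult_assoc)
qed

quotient_type cp2 = "complex^3" / partial: proj_rel
  morphisms rep_cp2 proj_pt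
  by (rule part_equivp_proj_rel)

text \<open>Only the values of \<^term>\<open>proj_pt\<close> at nonzero vectors are meaningful.\<close>

lemma proj_pt_eq_iff:
  "z \<noteq> 0 \<Longrightarrow> w \<noteq> 0 \<Longrightarrow> proj_pt z = proj_pt w \<longleftrightarrow> (\<exists>c. w = c *s z)"
  using Quotient3_rel[OF Quotient3_cp2, of z w] proj_rel_refl[of z] proj_rel_refl[of w]
  by (auto simp: proj_rel_def)

lemma proj_pt_cases:
  obtains z where "z \<noteq> 0" "x = proj_pt z"
  by (metis Quotient3_abs_rep Quotient3_cp2 Quotient3_rep_reflp proj_rel_def)

text \<open>The quotient topology. A set is open iff its preimage, the corresponding cone of nonzero
  vectors, is open.\<close>

instantiation cp2 :: topological_space
begin

definition open_cp2 :: "cp2 set \<Rightarrow> bool" where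
  "open_cp2 U \<longleftrightarrow> open {z. z \<noteq> 0 \<and> proj_pt z \<in> U}"

instance
proof
  show "open (UNIV :: cp2 set)"
    using open_delete[OF open_UNIV, of "0 :: complex^3"]
    by (simp add: open_cp2_def Collect_neg_eq Compl_eq_Diff_UNIV)
next
  fix S T :: "cp2 set" assume "open S" "open T"
  then have "open ({z. z \<noteq> 0 \<and> proj_pt z \<in> S} \<inter> {z. z \<noteq> 0 \<and> proj_pt z \<in> T})"
    unfolding open_cp2_def by (rule open_Int)
  also have "\<dots> = {z. z \<noteq> 0 \<and> proj_pt z \<in> S \<inter> T}" by auto
  finally show "open (S \<inter> T)" by (simp add: open_cp2_def)
next
  fix K :: "cp2 set set" assume "\<forall>S\<in>K. open S"
  then have "open (\<Union>S\<in>K. {z. z \<noteq> 0 \<and> proj_pt z \<in> S})"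
    by (intro open_UN) (auto simp: open_cp2_def)
  also have "\<dots> = {z. z \<noteq> 0 \<and> proj_pt z \<in> \<Union>K}" by auto
  finally show "open (\<Union>K)" by (simp add: open_cp2_def)
qed

end


section \<open>The complex hyperbolic plane\<close>

text \<open>The number \<^term>\<open>herm z z\<close> is real, see \<open>Im_herm_self\<close> below.\<close>

definition HC2 :: "cp2 set" where
  "HC2 = {proj_pt z | z. z \<noteq> 0 \<and> Re (herm z z) < 0}"

definition boundary_HC2 :: "cp2 set" where
  "boundary_HC2 = {proj_pt z | z. z \<noteq> 0 \<and> herm z z = 0}"

lemma herm_scale [simp]: "herm (c *s z) w = c * herm z w" "herm z (c *s w) = cnj c * herm z w"
  by (simp_all add: herm_def algebra_simps)

lemma herm_diff: "herm (z - u) w = herm z w - herm u w" "herm z (w - u) = herm z w - herm z u"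
  by (simp_all add: herm_def algebra_simps)

lemma cnj_herm [simp]: "cnj (herm z w) = herm w z"
  by (simp add: herm_def algebra_simps)

lemma Im_herm_self [simp]: "Im (herm z z) = 0"
  by (simp add: herm_def)

lemma herm_self_eq: "herm z z = of_real (Re (herm z z))"
  by (simp add: complex_eq_iff)

lemma cmod_herm_commute: "cmod (herm z w) = cmod (herm w z)"
  by (metis cnj_herm complex_mod_cnj)

lemma herm_mult_herm: "herm z w * herm w z = of_real ((cmod (herm z w))\<^sup>2)"
  by (metis cnj_herm complex_norm_square)

lift_definition herm_ratio :: "cp2 \<Rightarrow> cp2 \<Rightarrow> complex" is
  "\<lambda>z w. herm z w * herm w z / (herm z z * herm w w)"
  by (auto simp: proj_rel_def)

lemma herm_ratio_proj_pt:
  assumes "z \<noteq> 0" "w \<noteq> 0"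
  shows "herm_ratio (proj_pt z) (proj_pt w) = herm z w * herm w z / (herm z z * herm w w)"
  using assms herm_ratio.abs_eq proj_rel_refl by blast

text \<open>The value 0 outside \<^term>\<open>HC2\<close> is a dummy. Inside, the defining equation for
  the squared hyperbolic cosine of half the distance is \<open>cosh_dist_HC2\<close> below.\<close>

definition dist_HC2 :: "cp2 \<Rightarrow> cp2 \<Rightarrow> real" where
  "dist_HC2 x y = (if x \<in> HC2 \<and> y \<in> HC2 then 2 * arcosh (sqrt (Re (herm_ratio x y))) else 0)"


subsection \<open>The distance satisfies its defining equation and is a metric\<close>

lemma Re_herm_self: "Re (herm z z) = (cmod (z$1))\<^sup>2 + (cmod (z$2))\<^sup>2 - (cmod (z$3))\<^sup>2"
  by (simp add: herm_def cmod_power2) (simp add: power2_eq_square)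

lemma cmod_CS2:
  "(cmod (a * cnj b + c * cnj d))\<^sup>2 \<le> ((cmod a)\<^sup>2 + (cmod c)\<^sup>2) * ((cmod b)\<^sup>2 + (cmod d)\<^sup>2)"
proof -
  have "((cmod a)\<^sup>2 + (cmod c)\<^sup>2) * ((cmod b)\<^sup>2 + (cmod d)\<^sup>2)
      = (cmod (a * cnj b + c * cnj d))\<^sup>2 + (cmod (a * d - c * b))\<^sup>2"
    by (simp add: cmod_power2) (simp add: power2_eq_square algebra_simps)
  then show ?thesis by simp
qed

lemma herm_orthogonal_pos:
  assumes y: "Re (herm y y) < 0" and u: "herm u y = 0" and "u \<noteq> 0"
  shows "Re (herm u u) > 0"
proof (rule ccontr)
  assume neg: "\<not> ?thesis"
  define A where "A = (cmod (u$1))\<^sup>2 + (cmod (u$2))\<^sup>2"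
  define B where "B = (cmod (y$1))\<^sup>2 + (cmod (y$2))\<^sup>2"
  have A0: "A \<ge> 0" and B0: "B \<ge> 0" by (auto simp: A_def B_def)
  have 1: "A \<le> (cmod (u$3))\<^sup>2" using neg by (simp add: Re_herm_self A_def)
  have 2: "B < (cmod (y$3))\<^sup>2" using y by (simp add: Re_herm_self B_def)
  have "u$1 * cnj (y$1) + u$2 * cnj (y$2) = u$3 * cnj (y$3)"
    using u by (simp add: herm_def)
  then have 3: "(cmod (u$3))\<^sup>2 * (cmod (y$3))\<^sup>2 \<le> A * B"
    using cmod_CS2[of "u$1" "y$1" "u$2" "y$2"]
    by (simp add: A_def B_def norm_mult power_mult_distrib)
  have "A * B \<le> (cmod (u$3))\<^sup>2 * B" using 1 B0 by (rule mult_right_mono)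
  with 3 have "(cmod (u$3))\<^sup>2 * ((cmod (y$3))\<^sup>2 - B) \<le> 0" by (simp add: algebra_simps)
  then have "(cmod (u$3))\<^sup>2 \<le> 0" using 2 by (simp add: mult_le_0_iff)
  then have "cmod (u$3) = 0" by simp
  with 1 A0 have "A = 0" "u$3 = 0" by auto
  then have "u$1 = 0" "u$2 = 0" by (auto simp: A_def sum_power2_eq_zero_iff)
  with \<open>u$3 = 0\<close> have "u = 0" by (simp add: vec_eq_iff forall_3)
  with \<open>u \<noteq> 0\<close> show False by simp
qed

lemma herm_orthogonal_CS:
  assumes y: "Re (herm y y) < 0" and a: "herm a y = 0" and b: "herm b y = 0"
  shows "(cmod (herm a b))\<^sup>2 \<le> Re (herm a a) * Re (herm b b)"
proof (cases "b = 0")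
  case True
  then show ?thesis by (simp add: herm_def)
next
  case False
  define p where "p = Re (herm b b)"
  have p: "p > 0" using herm_orthogonal_pos[OF y b False] by (simp add: p_def)
  define v where "v = of_real p *s a - herm a b *s b"
  have "herm v y = 0" by (simp add: v_def herm_diff a b)
  then have "Re (herm v v) \<ge> 0"
    using herm_orthogonal_pos[OF y, of v] by (cases "v = 0") (auto simp: herm_def)
  also have "herm v v = of_real (p * (p * Re (herm a a) - (cmod (herm a b))\<^sup>2))"
  proof -
    have hb: "herm b b = of_real p" using herm_self_eq p_def by metis
    have "herm v v = p * p * herm a a - p * (herm a b * herm b a) - p * (herm a b * herm b a)
        + herm a b * herm b a * herm b b"
      by (simp add: v_def herm_diff algebra_simps)
    also have "\<dots> = p * p * herm a a - p * (herm a b * herm b a)"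
      by (simp add: hb)
    also have "\<dots> = of_real (p * (p * Re (herm a a) - (cmod (herm a b))\<^sup>2))"
      by (subst herm_self_eq, subst herm_mult_herm) (simp add: algebra_simps)
    finally show ?thesis .
  qed
  finally show ?thesis using p by (simp add: zero_le_mult_iff p_def mult.commute)
qed

text \<open>The component of \<open>x\<close> orthogonal to the negative vector \<open>y\<close>.\<close>

definition herm_perp :: "complex^3 \<Rightarrow> complex^3 \<Rightarrow> complex^3" where
  "herm_perp y x = x - (herm x y / herm y y) *s y"

lemma herm_perp:
  assumes "Re (herm y y) < 0"
  shows "herm (herm_perp y x) y = 0"
    and "herm (herm_perp y x) (herm_perp y z) = herm x z - herm x y * herm y z / herm y y"
proof -
  have "herm y y \<noteq> 0" using assms by force
  then show "herm (herm_perp y x) y = 0"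
    and "herm (herm_perp y x) (herm_perp y z) = herm x z - herm x y * herm y z / herm y y"
    by (simp_all add: herm_perp_def herm_diff field_simps)
qed

lemma herm_perp_self:
  assumes "Re (herm y y) < 0"
  shows "Re (herm (herm_perp y x) (herm_perp y x))
    = Re (herm x x) - (cmod (herm x y))\<^sup>2 / Re (herm y y)"
proof -
  have "herm x y * herm y x / herm y y = of_real ((cmod (herm x y))\<^sup>2 / Re (herm y y))"
    by (subst herm_mult_herm, subst herm_self_eq) simp
  then show ?thesis by (simp add: herm_perp(2)[OF assms])
qed

lemma reverse_CS:
  assumes x: "Re (herm x x) < 0" and y: "Re (herm y y) < 0"
  shows "Re (herm x x) * Re (herm y y) \<le> (cmod (herm x y))\<^sup>2"
    and "Re (herm x x) * Re (herm y y) = (cmod (herm x y))\<^sup>2 \<Longrightarrow> \<exists>c. x = c *s y"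
proof -
  have e: "Re (herm (herm_perp y x) (herm_perp y x)) * Re (herm y y)
      = Re (herm x x) * Re (herm y y) - (cmod (herm x y))\<^sup>2"
    using y by (simp add: herm_perp_self[OF y] field_simps)
  show "Re (herm x x) * Re (herm y y) \<le> (cmod (herm x y))\<^sup>2"
  proof (cases "herm_perp y x = 0")
    case True
    then show ?thesis using e by (simp add: herm_def)
  next
    case False
    then have "Re (herm (herm_perp y x) (herm_perp y x)) * Re (herm y y) < 0"
      using herm_orthogonal_pos[OF y herm_perp(1)[OF y]] y by (simp add: mult_less_0_iff)
    then show ?thesis using e by simp
  qed
  assume "Re (herm x x) * Re (herm y y) = (cmod (herm x y))\<^sup>2"
  then have "herm_perp y x = 0"
    using e herm_orthogonal_pos[OF y herm_perp(1)[OF y, of x]] y by auto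
  then show "\<exists>c. x = c *s y" by (auto simp: herm_perp_def)
qed

lemma HC2_cases:
  assumes "x \<in> HC2"
  obtains z where "z \<noteq> 0" "Re (herm z z) < 0" "x = proj_pt z"
  using assms by (auto simp: HC2_def)

lemma herm_ratio_Re:
  assumes "z \<noteq> 0" "w \<noteq> 0"
  shows "herm_ratio (proj_pt z) (proj_pt w)
    = of_real ((cmod (herm z w))\<^sup>2 / (Re (herm z z) * Re (herm w w)))"
proof -
  have "herm z z * herm w w = of_real (Re (herm z z) * Re (herm w w))"
    by (metis herm_self_eq of_real_mult)
  then show ?thesis by (simp add: herm_ratio_proj_pt[OF assms] herm_mult_herm)
qed

lemma herm_ratio_ge_1:
  assumes "x \<in> HC2" "y \<in> HC2"
  shows "Re (herm_ratio x y) \<ge> 1"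
proof -
  obtain z w where z: "z \<noteq> 0" "Re (herm z z) < 0" "x = proj_pt z"
    and w: "w \<noteq> 0" "Re (herm w w) < 0" "y = proj_pt w"
    using assms by (meson HC2_cases)
  have "Re (herm z z) * Re (herm w w) > 0" using z w by (simp add: mult_neg_neg)
  then show ?thesis using reverse_CS(1)[OF z(2) w(2)] z w by (simp add: herm_ratio_Re)
qed

lemma dist_HC2_nonneg: "x \<in> HC2 \<Longrightarrow> y \<in> HC2 \<Longrightarrow> dist_HC2 x y \<ge> 0"
  using herm_ratio_ge_1 by (simp add: dist_HC2_def)

lemma cosh_half_dist: "x \<in> HC2 \<Longrightarrow> y \<in> HC2 \<Longrightarrow> cosh (dist_HC2 x y / 2) = sqrt (Re (herm_ratio x y))"
  using herm_ratio_ge_1 by (simp add: dist_HC2_def)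

theorem cosh_dist_HC2:
  assumes "Re (herm z z) < 0" "Re (herm w w) < 0"
  shows "of_real ((cosh (dist_HC2 (proj_pt z) (proj_pt w) / 2))\<^sup>2)
    = herm z w * herm w z / (herm z z * herm w w)"
proof -
  have nz: "z \<noteq> 0" "w \<noteq> 0" using assms by (auto simp: herm_def)
  then have "proj_pt z \<in> HC2" "proj_pt w \<in> HC2" using assms by (auto simp: HC2_def)
  then have "(cosh (dist_HC2 (proj_pt z) (proj_pt w) / 2))\<^sup>2 = Re (herm_ratio (proj_pt z) (proj_pt w))"
    using cosh_half_dist herm_ratio_ge_1[of "proj_pt z" "proj_pt w"] by simp
  then show ?thesis
    using herm_ratio_Re[OF nz] herm_ratio_proj_pt[OF nz] by simp
qed

lemma dist_HC2_triangle:
  assumes "x \<in> HC2" "y \<in> HC2" "z \<in> HC2"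
  shows "dist_HC2 x z \<le> dist_HC2 x y + dist_HC2 y z"
proof -
  obtain a b c where a: "a \<noteq> 0" "Re (herm a a) < 0" "x = proj_pt a"
    and b: "b \<noteq> 0" "Re (herm b b) < 0" "y = proj_pt b"
    and c: "c \<noteq> 0" "Re (herm c c) < 0" "z = proj_pt c"
    using assms by (meson HC2_cases)
  define A B C where "A = - Re (herm a a)" and "B = - Re (herm b b)" and "C = - Re (herm c c)"
  have pos: "A > 0" "B > 0" "C > 0" using a b c by (auto simp: A_def B_def C_def)
  define p q r where "p = cmod (herm a b)" and "q = cmod (herm b c)" and "r = cmod (herm a c)"
  have r_xy: "Re (herm_ratio x y) = p\<^sup>2 / (A * B)"
    and r_yz: "Re (herm_ratio y z) = q\<^sup>2 / (B * C)"
    and r_xz: "Re (herm_ratio x z) = r\<^sup>2 / (A * C)"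
    using a b c by (simp_all add: herm_ratio_Re A_def B_def C_def p_def q_def r_def)
  let ?s = "dist_HC2 x y / 2" and ?t = "dist_HC2 y z / 2" and ?u = "dist_HC2 x z / 2"
  have nonneg: "?s \<ge> 0" "?t \<ge> 0" "?u \<ge> 0" using assms by (simp_all add: dist_HC2_nonneg)
  have pqr: "p \<ge> 0" "q \<ge> 0" "r \<ge> 0" by (simp_all add: p_def q_def r_def)
  have chs: "cosh ?s = p / sqrt (A * B)" and cht: "cosh ?t = q / sqrt (B * C)"
    and chu: "cosh ?u = r / sqrt (A * C)"
    using assms pqr by (simp_all add: cosh_half_dist r_xy r_yz r_xz real_sqrt_divide)
  define P Q where "P = herm_perp b a" and "Q = herm_perp b c"
  have NP: "Re (herm P P) = p\<^sup>2 / B - A" and NQ: "Re (herm Q Q) = q\<^sup>2 / B - C"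
    unfolding P_def Q_def A_def B_def C_def p_def q_def
      herm_perp_self[OF b(2)] cmod_herm_commute[of b c] by simp_all
  have shs: "(sinh ?s)\<^sup>2 = Re (herm P P) / A"
  proof -
    have "(sinh ?s)\<^sup>2 = (cosh ?s)\<^sup>2 - 1" by (simp add: sinh_square_eq)
    also have "\<dots> = p\<^sup>2 / (A * B) - 1" using pos by (simp add: chs power_divide)
    also have "\<dots> = Re (herm P P) / A" using pos by (simp add: NP field_simps)
    finally show ?thesis .
  qed
  have sht: "(sinh ?t)\<^sup>2 = Re (herm Q Q) / C"
  proof -
    have "(sinh ?t)\<^sup>2 = (cosh ?t)\<^sup>2 - 1" by (simp add: sinh_square_eq)
    also have "\<dots> = q\<^sup>2 / (B * C) - 1" using pos by (simp add: cht power_divide)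
    also have "\<dots> = Re (herm Q Q) / C" using pos by (simp add: NQ field_simps)
    finally show ?thesis .
  qed
  have sh0: "sinh ?s \<ge> 0" "sinh ?t \<ge> 0" using nonneg by simp_all
  have "(cmod (herm P Q))\<^sup>2 \<le> Re (herm P P) * Re (herm Q Q)"
    using herm_orthogonal_CS[OF b(2)] herm_perp(1)[OF b(2)] by (simp add: P_def Q_def)
  also have "\<dots> = (sinh ?s * sinh ?t * sqrt (A * C))\<^sup>2"
    using pos by (simp add: power_mult_distrib shs sht)
  finally have hPQ: "cmod (herm P Q) \<le> sinh ?s * sinh ?t * sqrt (A * C)"
    by (rule power2_le_imp_le) (use sh0 pos in auto)
  have "herm a c = herm P Q + herm a b * herm b c / herm b b"
    by (simp add: P_def Q_def herm_perp(2)[OF b(2)])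
  then have "r \<le> cmod (herm P Q) + cmod (herm a b * herm b c / herm b b)"
    unfolding r_def by (metis norm_triangle_ineq)
  moreover have "cmod (herm b b) = B"
    using pos(2) arg_cong[OF herm_self_eq[of b], of cmod] unfolding norm_of_real B_def by linarith
  then have "cmod (herm a b * herm b c / herm b b) = p * q / B"
    unfolding norm_mult norm_divide p_def q_def by simp
  moreover have "p * q / B = cosh ?s * cosh ?t * sqrt (A * C)"
  proof -
    have "cosh ?s * cosh ?t * sqrt (A * C)
        = (p * q / (sqrt B * sqrt B)) * ((sqrt A * sqrt C) / (sqrt A * sqrt C))"
      unfolding chs cht real_sqrt_mult by (simp add: mult_ac)
    also have "\<dots> = (p * q / B) * 1"
      using pos by (intro arg_cong2[where f="(*)"] arg_cong2[where f="(/)"]) auto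
    finally show ?thesis by simp
  qed
  ultimately have "r \<le> (cosh ?s * cosh ?t + sinh ?s * sinh ?t) * sqrt (A * C)"
    using hPQ by (simp add: algebra_simps)
  then have "cosh ?u \<le> cosh (?s + ?t)"
    unfolding chu cosh_add using pos by (simp add: pos_divide_le_eq)
  then have "?u \<le> ?s + ?t" using nonneg by (simp add: cosh_real_nonneg_le_iff)
  then show ?thesis by simp
qed

lemma dist_HC2_commute: "dist_HC2 x y = dist_HC2 y x"
proof -
  obtain z w where "z \<noteq> 0" "x = proj_pt z" "w \<noteq> 0" "y = proj_pt w"
    by (metis proj_pt_cases)
  then have "herm_ratio x y = herm_ratio y x" by (simp add: herm_ratio_proj_pt mult.commute)
  then show ?thesis by (simp add: dist_HC2_def)
qed

lemma dist_HC2_eq_0_iff: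
  assumes "x \<in> HC2" "y \<in> HC2"
  shows "dist_HC2 x y = 0 \<longleftrightarrow> x = y"
proof -
  obtain z w where z: "z \<noteq> 0" "Re (herm z z) < 0" "x = proj_pt z"
    and w: "w \<noteq> 0" "Re (herm w w) < 0" "y = proj_pt w"
    using assms by (meson HC2_cases)
  have pos: "Re (herm z z) * Re (herm w w) > 0" using z w by (simp add: mult_neg_neg)
  have "dist_HC2 x y = 0 \<longleftrightarrow> Re (herm_ratio x y) = 1"
    using herm_ratio_ge_1[OF assms] assms by (simp add: dist_HC2_def)
  also have "\<dots> \<longleftrightarrow> Re (herm w w) * Re (herm z z) = (cmod (herm w z))\<^sup>2"
  proof -
    have "Re (herm_ratio x y) = (cmod (herm w z))\<^sup>2 / (Re (herm w w) * Re (herm z z))"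
      by (simp add: z(3) w(3) herm_ratio_Re[OF z(1) w(1)] cmod_herm_commute[of z w] mult.commute)
    then show ?thesis using z(2) w(2) by (auto simp: divide_eq_1_iff)
  qed
  also have "\<dots> \<longleftrightarrow> x = y"
  proof
    assume "Re (herm w w) * Re (herm z z) = (cmod (herm w z))\<^sup>2"
    then show "x = y" using reverse_CS(2)[OF w(2) z(2)] z w by (simp add: proj_pt_eq_iff)
  next
    assume "x = y"
    then obtain c where c: "w = c *s z" using z w by (auto simp: proj_pt_eq_iff)
    define n where "n = Re (herm z z)"
    have "herm z z = of_real n" using herm_self_eq n_def by metis
    then show "Re (herm w w) * Re (herm z z) = (cmod (herm w z))\<^sup>2"
      by (simp add: c norm_mult power_mult_distrib cmod_power2) (simp add: power2_eq_square algebra_simps)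
  qed
  finally show ?thesis .
qed

theorem Metric_space_HC2: "Metric_space HC2 dist_HC2"
proof
  fix x y show "0 \<le> dist_HC2 x y"
    using dist_HC2_nonneg by (cases "x \<in> HC2 \<and> y \<in> HC2") (auto simp: dist_HC2_def)
qed (auto simp: dist_HC2_commute dist_HC2_eq_0_iff dist_HC2_triangle)


section \<open>Holomorphic isometries and their axes\<close>

text \<open>Elements of PU(2,1) are represented by the (faithful) action of the group on the whole
  projective plane, which contains the boundary as well.\<close>

definition U21 :: "(complex^3^3) set" where
  "U21 = {A. \<forall>z w. herm (A *v z) (A *v w) = herm z w}"

definition PU21 :: "(cp2 \<Rightarrow> cp2) set" where
  "PU21 = {g. \<exists>A\<in>U21. \<forall>z. z \<noteq> 0 \<longrightarrow> g (proj_pt z) = proj_pt (A *v z)}"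

definition loxodromic :: "(cp2 \<Rightarrow> cp2) \<Rightarrow> bool" where
  "loxodromic g \<longleftrightarrow> g \<in> PU21 \<and> card {p \<in> boundary_HC2. g p = p} = 2 \<and> (\<forall>x\<in>HC2. g x \<noteq> x)"

text \<open>\<open>L\<close> is a complete geodesic of the complex hyperbolic plane, whose two ends converge (in
  the projective plane) to \<open>p\<close> and \<open>q\<close>.\<close>

definition geodesic_joining :: "cp2 \<Rightarrow> cp2 \<Rightarrow> cp2 set \<Rightarrow> bool" where
  "geodesic_joining p q L \<longleftrightarrow>
    (\<exists>c :: real \<Rightarrow> cp2. range c = L \<and> L \<subseteq> HC2 \<and>
      (\<forall>s t. dist_HC2 (c s) (c t) = \<bar>s - t\<bar>) \<and>
      (c \<longlongrightarrow> p) at_bot \<and> (c \<longlongrightarrow> q) at_top)"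

definition invariant_axis :: "(cp2 \<Rightarrow> cp2) \<Rightarrow> cp2 set \<Rightarrow> bool" where
  "invariant_axis g L \<longleftrightarrow>
    (\<exists>p q. p \<noteq> q \<and> {x \<in> boundary_HC2. g x = x} = {p, q} \<and> geodesic_joining p q L)"


section \<open>Dirichlet domains in the product\<close>

abbreviation HH :: "(cp2 \<times> cp2) set" where
  "HH \<equiv> HC2 \<times> HC2"

abbreviation rho :: "cp2 \<times> cp2 \<Rightarrow> cp2 \<times> cp2 \<Rightarrow> real" where
  "rho \<equiv> prod_dist dist_HC2 dist_HC2"

lemma Metric_space_HH: "Metric_space HH rho"
  using Metric_space12.prod_metric Metric_space_HC2 Metric_space12.intro by blast

lemma rho_eq: "rho (z1, z2) (w1, w2) = sqrt ((dist_HC2 z1 w1)\<^sup>2 + (dist_HC2 z2 w2)\<^sup>2)"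
  by (simp add: prod_dist_def)

definition bisector :: "cp2 \<times> cp2 \<Rightarrow> cp2 \<times> cp2 \<Rightarrow> (cp2 \<times> cp2) set" where
  "bisector z w = {x \<in> HH. rho x z = rho x w}"

text \<open>The cyclic group generated by a bijection.\<close>

definition cyclic_group :: "('a \<Rightarrow> 'a) \<Rightarrow> ('a \<Rightarrow> 'a) set" where
  "cyclic_group \<gamma> = range (\<lambda>n. \<gamma> ^^ n) \<union> range (\<lambda>n. inv \<gamma> ^^ n)"

definition dirichlet_domain :: "(cp2 \<times> cp2 \<Rightarrow> cp2 \<times> cp2) \<Rightarrow> cp2 \<times> cp2 \<Rightarrow> (cp2 \<times> cp2) set" where
  "dirichlet_domain \<gamma> z = {x \<in> HH. \<forall>g \<in> cyclic_group \<gamma> - {id}. rho x z \<le> rho (g x) z}"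

definition face :: "(cp2 \<times> cp2 \<Rightarrow> cp2 \<times> cp2) \<Rightarrow> cp2 \<times> cp2 \<Rightarrow> (cp2 \<times> cp2 \<Rightarrow> cp2 \<times> cp2)
    \<Rightarrow> (cp2 \<times> cp2) set" where
  "face \<gamma> z g = dirichlet_domain \<gamma> z \<inter> bisector z (g z)"

definition corresponds_to_face ::
  "(cp2 \<times> cp2 \<Rightarrow> cp2 \<times> cp2) \<Rightarrow> cp2 \<times> cp2 \<Rightarrow> (cp2 \<times> cp2 \<Rightarrow> cp2 \<times> cp2) \<Rightarrow> bool" where
  "corresponds_to_face \<gamma> z g \<longleftrightarrow>
    g \<in> cyclic_group \<gamma> - {id} \<and>
    subtopology (Metric_space.mtopology HH rho) (bisector z (g z)) interior_of face \<gamma> z g \<noteq> {}"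

end

theory Submission
  imports Defs
begin

text \<open>A loxodromic isometry translates its axis by a nonzero amount, so the points \<open>\<gamma>\<^sup>n(z)\<close> are
  equally spaced, at some distance \<open>L > 0\<close>, along a geodesic \<open>C\<close> of the product. Let \<open>m\<close> be
  the midpoint of \<open>z\<close> and \<open>\<gamma>(z)\<close>. Its distance to either of these is \<open>L / 2\<close>, while
  its distance to any other point of the orbit is at least \<open>3 L / 2\<close>. By the triangle inequality
  every point within \<open>L / 2\<close> of \<open>m\<close> is closer to \<open>z\<close> than to those other points, so the
  part of the bisector \<open>E(z, \<gamma>(z))\<close> in this ball lies in the Dirichlet domain. Hence
  \<open>m\<close> is an interior point of the face. It does not lie on \<open>E(z, \<gamma>\<^sup>-\<^sup>1(z))\<close>, as it is
  \<open>L / 2\<close> from \<open>z\<close> and \<open>3 L / 2\<close> from \<open>\<gamma>\<^sup>-\<^sup>1(z)\<close>. This separates the two faces, and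
  the claim for \<open>\<gamma>\<^sup>-\<^sup>1\<close> follows by running along \<open>C\<close> backwards
  (\<open>faces_across_axis\<close>).

  The work lies in the first clause (\<open>loxodromic_translates_axis\<close>). A geodesic is only given as an
  isometric embedding of the line that converges to the two fixed points in the projective plane,
  and it has to be identified as a curve. Equality in the Cauchy-Schwarz inequality forces it to be
  \<open>[cosh(t/2) v + sinh(t/2) w]\<close> with \<open>v\<close> negative and \<open>w\<close> positive, of norms \<open>-1\<close>
  and \<open>1\<close> and orthogonal (\<open>geodesic_hyperbolic_form\<close>), that is
  \<open>[e\<^sup>t\<^sup>/\<^sup>2 Q + e\<^sup>-\<^sup>t\<^sup>/\<^sup>2 P]\<close> for the null vectors
  \<open>Q = v + w\<close> and \<open>P = v - w\<close>, and these represent its endpoints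
  (\<open>geodesic_joining_exp_form\<close>). The endpoints being fixed, \<open>P\<close> and \<open>Q\<close> are
  eigenvectors of a matrix that preserves the Hermitian form, and their eigenvalues \<open>\<lambda>\<close> and
  \<open>\<mu>\<close> satisfy \<open>\<lambda> cnj(\<mu>) = 1\<close>. They therefore have the same argument, which is lost in the
  projective plane, and inverse moduli, which act as the translation \<open>t \<mapsto> t + 2 ln |\<mu>|\<close>.\<close>

section \<open>Geodesics of the complex hyperbolic plane\<close>

lemma herm_add: "herm (z + u) w = herm z w + herm u w" "herm z (w + u) = herm z w + herm z u"
  by (simp_all add: herm_def algebra_simps)

lemma herm_zero [simp]: "herm 0 w = 0" "herm z 0 = 0"
  by (simp_all add: herm_def)

lemma herm_eq_0_commute: "herm z w = 0 \<longleftrightarrow> herm w z = 0"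
  by (metis cnj_herm complex_cnj_zero_iff)

lemma proj_pt_scale:
  assumes "c \<noteq> 0" "z \<noteq> 0"
  shows "proj_pt (c *s z) = proj_pt z"
proof -
  have "c *s z \<noteq> 0" using assms by simp
  then show ?thesis using proj_pt_eq_iff[of z "c *s z"] assms by metis
qed

lemma proj_pt_in_HC2: "Re (herm z z) < 0 \<Longrightarrow> proj_pt z \<in> HC2"
  by (auto simp: HC2_def)

lemma cosh_half_dist_proj_pt:
  assumes "herm v v = -1" "herm w w = -1"
  shows "cosh (dist_HC2 (proj_pt v) (proj_pt w) / 2) = cmod (herm v w)"
proof -
  have "v \<noteq> 0" "w \<noteq> 0" using assms by auto
  then show ?thesis
    using assms by (simp add: cosh_half_dist proj_pt_in_HC2 herm_ratio_Re)
qed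

lemma normalized_lift:
  assumes "x \<in> HC2" "herm v v = -1"
  obtains w where "herm w w = -1" "x = proj_pt w"
    "herm w v = - of_real (cosh (dist_HC2 x (proj_pt v) / 2))"
proof -
  obtain z where z: "z \<noteq> 0" "Re (herm z z) < 0" "x = proj_pt z"
    using assms(1) by (rule HC2_cases)
  define n where "n = - Re (herm z z)"
  have n: "n > 0" "herm z z = - of_real n"
    using z herm_self_eq[of z] by (auto simp: n_def)
  define C where "C = cosh (dist_HC2 x (proj_pt v) / 2)"
  have C: "C > 0" by (simp add: C_def)
  have "v \<noteq> 0" using assms by auto
  then have "C = sqrt ((cmod (herm z v))\<^sup>2 / n)"
    using z assms by (simp add: C_def cosh_half_dist proj_pt_in_HC2 herm_ratio_Re n_def)
  then have C2: "C\<^sup>2 = (cmod (herm z v))\<^sup>2 / n" using n by simp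
  then have nz: "herm z v \<noteq> 0" using C by auto
  \<comment> \<open>The modulus of this factor normalizes the lift, its argument makes the product with v real.\<close>
  define k where "k = - of_real C / herm z v"
  have k: "k \<noteq> 0" using C nz by (simp add: k_def)
  have "(cmod k)\<^sup>2 * n = 1"
    using C2 n nz by (simp add: k_def norm_divide power_divide)
  then have "k * cnj k * of_real n = 1"
    by (metis complex_norm_square of_real_1 of_real_mult)
  then have "herm (k *s z) (k *s z) = -1"
    by (simp add: n(2) ac_simps)
  moreover have "herm (k *s z) v = - of_real C" unfolding herm_scale using nz by (simp add: k_def)
  ultimately show thesis
    using that[of "k *s z"] z k by (simp add: proj_pt_scale C_def)
qed

text \<open>The equality case behind the rigidity of geodesics. Three points at parameters \<open>0\<close>,
  \<open>2p\<close>, \<open>2q\<close> of a geodesic give such an equation, where \<open>h\<close> is the Hermitian product of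
  the unit directions at the first point of the lines to the others, oriented by increasing
  parameter. Squaring it leaves
  \<open>2 cosh p cosh q (1 - Re h) = sinh p sinh q (1 - |h|\<^sup>2)\<close>, where \<open>1 - |h|\<^sup>2\<close> is at most
  \<open>2 (1 - Re h)\<close> and \<open>|sinh p sinh q| < cosh p cosh q\<close>. The case of parameters on opposite
  sides of \<open>0\<close>, where the hyperbolic sines have a negative product, is included.\<close>

lemma Re_eq_1_of_cosh_diff:
  fixes h :: complex and p q :: real
  assumes "p \<noteq> 0" "q \<noteq> 0" "cmod h \<le> 1"
    and "cmod (of_real (sinh p * sinh q) * h - of_real (cosh p * cosh q)) = cosh (p - q)"
  shows "Re h = 1"
proof -
  define a b where "a = cosh p * cosh q" and "b = sinh p * sinh q"
  have ab: "cosh (p - q) = a - b" "cosh (p + q) = a + b"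
    by (simp_all add: a_def b_def cosh_diff cosh_add)
  have pos: "a - b > 0" "a + b > 0" by (simp_all flip: ab)
  have b: "b \<noteq> 0" using assms by (simp add: b_def)
  have "(cmod (of_real b * h - of_real a))\<^sup>2 = (a - b)\<^sup>2"
    using assms(4) by (simp add: ab flip: a_def b_def)
  then have "(b * Re h - a)\<^sup>2 + (b * Im h)\<^sup>2 = (a - b)\<^sup>2"
    by (simp add: cmod_power2)
  then have "b * (2 * a * (1 - Re h)) = b * (b * (1 - (Re h)\<^sup>2 - (Im h)\<^sup>2))"
    by (simp add: power2_eq_square algebra_simps)
  then have e: "2 * a * (1 - Re h) = b * (1 - (Re h)\<^sup>2 - (Im h)\<^sup>2)"
    using b by simp
  have "(cmod h)\<^sup>2 \<le> 1" using assms(3) by (simp add: power_le_one)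
  then have h: "1 - (Re h)\<^sup>2 - (Im h)\<^sup>2 \<ge> 0" by (simp add: cmod_power2)
  have r: "Re h \<le> 1" using assms(3) complex_Re_le_cmod[of h] by linarith
  have "2 * (1 - Re h) = 1 - (Re h)\<^sup>2 + (1 - Re h)\<^sup>2"
    by (simp add: power2_eq_square algebra_simps)
  then have h2: "1 - (Re h)\<^sup>2 - (Im h)\<^sup>2 \<le> 2 * (1 - Re h)" by simp
  have "(a - b) * (1 - Re h) \<le> 0 \<or> a * (1 - Re h) \<le> 0"
  proof (cases "b > 0")
    case True
    then have "b * (1 - (Re h)\<^sup>2 - (Im h)\<^sup>2) \<le> b * (2 * (1 - Re h))"
      by (intro mult_left_mono h2) simp
    then show ?thesis using e by (simp add: algebra_simps)
  next
    case False
    then have "b * (1 - (Re h)\<^sup>2 - (Im h)\<^sup>2) \<le> 0"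
      using h by (simp add: mult_nonpos_nonneg)
    then show ?thesis using e by simp
  qed
  moreover have "a > 0" using pos by simp
  ultimately show ?thesis using pos r by (auto simp: mult_le_0_iff)
qed

text \<open>Relative to the point \<open>[v]\<close> at time \<open>0\<close>, each other point of the geodesic determines
  a unit direction, oriented by increasing time, in the positive definite complement of \<open>v\<close>. Any two such directions have
  Hermitian product with real part \<open>1\<close>, so they are equal.\<close>

lemma geodesic_hyperbolic_form:
  fixes c :: "real \<Rightarrow> cp2"
  assumes "range c \<subseteq> HC2" and d: "\<And>s t. dist_HC2 (c s) (c t) = \<bar>s - t\<bar>"
  obtains v w where "herm v v = -1" "herm w w = 1" "herm w v = 0"
    "\<And>t. c t = proj_pt (of_real (cosh (t / 2)) *s v + of_real (sinh (t / 2)) *s w)"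
proof -
  have cH: "c t \<in> HC2" for t using assms(1) by auto
  obtain z where z: "Re (herm z z) < 0" "c 0 = proj_pt z" using cH HC2_cases by metis
  define n where "n = - Re (herm z z)"
  have n: "n > 0" "herm z z = - of_real n"
    using z herm_self_eq[of z] by (auto simp: n_def)
  define k :: complex where "k = of_real (1 / sqrt n)"
  have "k * cnj k * of_real n = 1"
    using n by (simp add: k_def field_simps flip: of_real_mult)
  then have v: "herm (k *s z) (k *s z) = -1"
    by (simp add: n(2) ac_simps)
  have kz: "k \<noteq> 0" "z \<noteq> 0" using n by (auto simp: k_def)
  define v where "v = k *s z"
  have v1: "herm v v = -1" and c0: "c 0 = proj_pt v"
    using v z kz by (simp_all add: v_def proj_pt_scale)
  have "\<exists>u. herm u u = -1 \<and> c t = proj_pt u \<and> herm u v = - of_real (cosh (t / 2))" for t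
    using normalized_lift[OF cH v1, of t] d[of t 0] c0
    by (metis abs_divide abs_numeral cosh_real_abs diff_zero)
  then obtain V where V: "herm (V t) (V t) = -1" "c t = proj_pt (V t)"
    "herm (V t) v = - of_real (cosh (t / 2))" for t
    by metis
  \<comment> \<open>The unit direction at v of the line to the point at time t, oriented by increasing time.\<close>
  define W where "W t = of_real (1 / sinh (t / 2)) *s (V t - of_real (cosh (t / 2)) *s v)" for t :: real
  have VW: "V t = of_real (cosh (t / 2)) *s v + of_real (sinh (t / 2)) *s W t" if "t \<noteq> 0" for t
    using that unfolding W_def vector_smult_assoc by simp
  have Wv: "herm (W t) v = 0" and vW: "herm v (W t) = 0" for t
  proof -
    show "herm (W t) v = 0" by (simp add: W_def herm_diff V v1)
    then show "herm v (W t) = 0" using herm_eq_0_commute by blast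
  qed
  have VV: "herm (V s) (V t) = of_real (sinh (s/2) * sinh (t/2)) * herm (W s) (W t)
      - of_real (cosh (s/2) * cosh (t/2))" if "s \<noteq> 0" "t \<noteq> 0" for s t
    by (subst VW[OF that(1)], subst VW[OF that(2)])
      (simp add: herm_add v1 Wv vW algebra_simps)
  have WW: "herm (W t) (W t) = 1" if "t \<noteq> 0" for t
  proof -
    have "of_real (sinh (t/2) * sinh (t/2)) * herm (W t) (W t)
        = complex_of_real (cosh (t/2) * cosh (t/2) - 1)"
      using VV[OF that that] V(1)[of t] by (simp add: algebra_simps)
    also have "cosh (t/2) * cosh (t/2) - 1 = sinh (t/2) * sinh (t/2)"
      using sinh_square_eq[of "t/2"] by (simp add: power2_eq_square)
    finally show ?thesis using that by simp
  qed
  have Weq: "W t = W 1" if "t \<noteq> 0" for t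
  proof -
    have vneg: "Re (herm v v) < 0" by (simp add: v1)
    have "(cmod (herm (W t) (W 1)))\<^sup>2 \<le> 1"
      using herm_orthogonal_CS[OF vneg Wv Wv, of t 1] that by (simp add: WW)
    then have "cmod (herm (W t) (W 1)) \<le> 1" using power2_le_imp_le[of _ 1] by simp
    moreover have "cmod (herm (V t) (V 1)) = cosh (t/2 - 1/2)"
      using cosh_half_dist_proj_pt[OF V(1)[of t] V(1)[of 1]] d[of t 1]
      by (simp flip: V(2) add: diff_divide_distrib) 
        (metis abs_divide abs_numeral cosh_real_abs diff_divide_distrib)
    ultimately have R: "Re (herm (W t) (W 1)) = 1"
      using Re_eq_1_of_cosh_diff[of "t/2" "1/2" "herm (W t) (W 1)"] VV[of t 1] that by simp
    then have "Re (herm (W 1) (W t)) = 1"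
      by (metis cnj_herm cnj.sel(1))
    then have "Re (herm (W t - W 1) (W t - W 1)) = 0"
      using R WW that by (simp add: herm_diff)
    moreover have "herm (W t - W 1) v = 0" by (simp add: herm_diff Wv)
    ultimately show ?thesis using herm_orthogonal_pos[OF vneg, of "W t - W 1"] by fastforce
  qed
  have "c t = proj_pt (of_real (cosh (t / 2)) *s v + of_real (sinh (t / 2)) *s W 1)" for t
  proof (cases "t = 0")
    case False
    then show ?thesis using VW[OF False] Weq[OF False] V(2)[of t] by argo
  qed (simp add: c0)
  then show thesis using that[OF v1 WW[of 1] Wv] by simp
qed

text \<open>A subspace on which the form vanishes has dimension at most one. After subtracting a multiple
  of \<open>u\<close>, the vector \<open>n\<close> becomes orthogonal to a negative vector while still being null, so
  it becomes zero.\<close>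

lemma null_vectors_proportional:
  assumes v: "Re (herm v v) < 0" and u: "herm u u = 0" "u \<noteq> 0" and n: "herm n n = 0"
    and un: "herm u n = 0"
  shows "\<exists>k. n = k *s u"
proof -
  have uv: "herm u v \<noteq> 0" using herm_orthogonal_pos[OF v _ u(2)] u by fastforce
  have nu: "herm n u = 0" using un herm_eq_0_commute by blast
  define k where "k = herm n v / herm u v"
  have "herm (n - k *s u) v = 0" using uv by (simp add: k_def herm_diff)
  moreover have "herm (n - k *s u) (n - k *s u) = 0" by (simp add: herm_diff u n un nu)
  ultimately have "n - k *s u = 0" using herm_orthogonal_pos[OF v] by fastforce
  then show ?thesis by auto
qed

lemma tendsto_herm:
  "(f \<longlongrightarrow> a) F \<Longrightarrow> ((\<lambda>t. herm (f t) w) \<longlongrightarrow> herm a w) F"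
  unfolding herm_def by (intro tendsto_intros)

lemma continuous_on_herm: "continuous_on S (\<lambda>z. herm z w)"
  unfolding continuous_on_def by (auto intro: tendsto_herm)

lemma tendsto_smult_vec:
  fixes f :: "'a \<Rightarrow> complex"
  assumes "(f \<longlongrightarrow> a) F"
  shows "((\<lambda>t. f t *s x) \<longlongrightarrow> a *s x) F"
  by (rule vec_tendstoI) (simp add: tendsto_mult_right[OF assms])

text \<open>Limits at boundary points are unique, so the endpoints of a geodesic can be read off from a
  limit of lifts. The product with a lift \<open>n\<close> of \<open>q\<close>, measured against the product with
  a negative vector, is homogeneous of degree zero and hence a function on the projective plane.
  Its values along the curve tend to its value at \<open>q\<close>, which is \<open>0\<close>. Therefore \<open>u\<close>
  is orthogonal to \<open>n\<close>, and for null vectors this means proportional.\<close>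

lemma proj_pt_tendsto_null_unique:
  assumes F: "F \<noteq> bot" and v: "Re (herm v v) < 0"
    and V: "(V \<longlongrightarrow> u) F" "\<And>t. V t \<noteq> 0" and u: "u \<noteq> 0" "herm u u = 0"
    and q: "((\<lambda>t. proj_pt (V t)) \<longlongrightarrow> q) F" "q \<in> boundary_HC2"
  shows "proj_pt u = q"
proof -
  obtain n where n: "n \<noteq> 0" "herm n n = 0" "q = proj_pt n"
    using q(2) by (auto simp: boundary_HC2_def)
  have nv: "herm n v \<noteq> 0" using herm_orthogonal_pos[OF v _ n(1)] n(2) by fastforce
  have le: "cmod (herm u n) \<le> e * cmod (herm u v)" if e: "e > 0" for e
  proof -
    define U where "U = {proj_pt z | z. z \<noteq> 0 \<and> cmod (herm z n) < e * cmod (herm z v)}"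
    have U_iff: "proj_pt z \<in> U \<longleftrightarrow> cmod (herm z n) < e * cmod (herm z v)" if z: "z \<noteq> 0" for z
    proof
      assume "proj_pt z \<in> U"
      then obtain y where y: "y \<noteq> 0" "proj_pt y = proj_pt z" 
        "cmod (herm y n) < e * cmod (herm y v)" by (auto simp: U_def)
      then obtain k where k: "z = k *s y" using z proj_pt_eq_iff by blast
      with z have "k \<noteq> 0" by auto
      then have "cmod k * cmod (herm y n) < cmod k * (e * cmod (herm y v))"
        using y(3) by simp
      then show "cmod (herm z n) < e * cmod (herm z v)"
        by (simp add: k norm_mult mult.left_commute)
    qed (use z in \<open>auto simp: U_def\<close>)
    have "open ({z. cmod (herm z n) < e * cmod (herm z v)} - {0})"
      by (intro open_delete open_Collect_less continuous_intros continuous_on_herm)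
    moreover have "{z. cmod (herm z n) < e * cmod (herm z v)} - {0} = {z. z \<noteq> 0 \<and> proj_pt z \<in> U}"
    proof (rule set_eqI)
      show "z \<in> {z. cmod (herm z n) < e * cmod (herm z v)} - {0}
          \<longleftrightarrow> z \<in> {z. z \<noteq> 0 \<and> proj_pt z \<in> U}" for z
        by (cases "z = 0") (simp_all add: U_iff)
    qed
    ultimately have "open U" by (simp add: open_cp2_def)
    moreover have "q \<in> U" using n nv e U_iff[OF n(1)] by simp
    ultimately have "eventually (\<lambda>t. proj_pt (V t) \<in> U) F" using q(1) topological_tendstoD by blast
    then have "eventually (\<lambda>t. cmod (herm (V t) n) \<le> e * cmod (herm (V t) v)) F"
      by (rule eventually_mono) (use U_iff V(2) in force)
    then show ?thesis
      by (rule tendsto_le[OF F tendsto_mult_left[OF tendsto_norm[OF tendsto_herm[OF V(1)]]]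
            tendsto_norm[OF tendsto_herm[OF V(1)]]])
  qed
  have "cmod (herm u n) \<le> 0"
  proof (rule field_le_epsilon)
    fix e :: real assume e: "e > 0"
    define b where "b = cmod (herm u v)"
    have b: "b \<ge> 0" by (simp add: b_def)
    have "e / (b + 1) > 0" using e b by simp
    from le[OF this] have "cmod (herm u n) \<le> e / (b + 1) * b" by (simp only: b_def)
    also have "\<dots> \<le> e" using e b by (simp add: field_simps)
    finally show "cmod (herm u n) \<le> 0 + e" by simp
  qed
  then have "herm u n = 0" by simp
  then show ?thesis
    using null_vectors_proportional[OF v u(2,1) n(2)] n u proj_pt_eq_iff by metis
qed

text \<open>After rescaling the lift by \<open>e\<^sup>-\<^sup>t\<^sup>/\<^sup>2\<close> or \<open>e\<^sup>t\<^sup>/\<^sup>2\<close>, one of the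
  two summands stays fixed and the other tends to zero at the end in question.\<close>

lemma geodesic_joining_exp_form:
  assumes c: "range c \<subseteq> HC2" "\<And>s t. dist_HC2 (c s) (c t) = \<bar>s - t\<bar>"
    and lim: "(c \<longlongrightarrow> p) at_bot" "(c \<longlongrightarrow> q) at_top"
    and pq: "p \<in> boundary_HC2" "q \<in> boundary_HC2"
  obtains P Q where "P \<noteq> 0" "Q \<noteq> 0" "p = proj_pt P" "q = proj_pt Q" "herm P Q \<noteq> 0"
    "\<And>t. of_real (exp (t / 2)) *s Q + of_real (exp (- t / 2)) *s P \<noteq> 0"
    "\<And>t. c t = proj_pt (of_real (exp (t / 2)) *s Q + of_real (exp (- t / 2)) *s P)"
proof -
  obtain v w where v: "herm v v = -1" and w: "herm w w = 1" and wv: "herm w v = 0"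
    and ct: "\<And>t. c t = proj_pt (of_real (cosh (t / 2)) *s v + of_real (sinh (t / 2)) *s w)"
    using geodesic_hyperbolic_form[OF c] by metis
  have vw: "herm v w = 0" using wv herm_eq_0_commute by blast
  define P Q where "P = v - w" and "Q = v + w"
  define X where "X t = of_real (exp (t / 2)) *s Q + of_real (exp (- t / 2)) *s P" for t :: real
  have PQ: "herm P P = 0" "herm Q Q = 0" "herm P Q = -2" "herm Q P = -2"
    by (simp_all add: P_def Q_def herm_add herm_diff v w vw wv)
  have nz: "P \<noteq> 0" "Q \<noteq> 0" using PQ by auto
  have vneg: "Re (herm v v) < 0" by (simp add: v)
  have X: "herm (X t) (X t) = -4" for t
    by (simp add: X_def herm_add PQ flip: of_real_mult exp_add)
  have Xnz: "X t \<noteq> 0" for t using X[of t] by auto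
  \<comment> \<open>The coefficients of v and w in X t are the sum and the difference of the two exponentials.\<close>
  have "X t = 2 *s (of_real (cosh (t / 2)) *s v + of_real (sinh (t / 2)) *s w)" for t
    unfolding X_def P_def Q_def vec_eq_iff
    by (simp add: cosh_def sinh_def scaleR_conv_of_real algebra_simps)
  then have cX: "c t = proj_pt (X t)" for t
    using ct[of t] Xnz[of t] proj_pt_scale[of 2] by (metis vector_smult_rzero zero_neq_numeral)
  have top: "proj_pt Q = q"
  proof (rule proj_pt_tendsto_null_unique[OF _ vneg])
    let ?V = "\<lambda>t. of_real (exp (- t / 2)) *s X t"
    have e: "?V = (\<lambda>t. Q + of_real (exp (- t)) *s P)"
      by (auto simp: X_def vector_add_ldistrib vector_smult_assoc simp flip: of_real_mult exp_add)
    have "((\<lambda>t::real. exp (- t)) \<longlongrightarrow> 0) at_top"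
      by (intro filterlim_compose[OF exp_at_bot] filterlim_uminus_at_bot_at_top)
    from tendsto_of_real[OF this, where 'a = complex] show "(?V \<longlongrightarrow> Q) at_top" unfolding e
      using tendsto_smult_vec[of _ 0 at_top P] tendsto_add[OF tendsto_const[of Q]] by fastforce
    show "?V t \<noteq> 0" for t using Xnz by simp
    show "((\<lambda>t. proj_pt (?V t)) \<longlongrightarrow> q) at_top"
      using lim(2) by (simp add: proj_pt_scale Xnz flip: cX)
  qed (use nz PQ pq in auto)
  have bot: "proj_pt P = p"
  proof (rule proj_pt_tendsto_null_unique[OF _ vneg])
    let ?V = "\<lambda>t. of_real (exp (t / 2)) *s X t"
    have e: "?V = (\<lambda>t. P + of_real (exp t) *s Q)"
      by (auto simp: X_def vector_add_ldistrib vector_smult_assoc simp flip: of_real_mult exp_add)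
    from tendsto_of_real[OF exp_at_bot, where 'a = complex] show "(?V \<longlongrightarrow> P) at_bot" unfolding e
      using tendsto_smult_vec[of _ 0 at_bot Q] tendsto_add[OF tendsto_const[of P]] by fastforce
    show "?V t \<noteq> 0" for t using Xnz by simp
    show "((\<lambda>t. proj_pt (?V t)) \<longlongrightarrow> p) at_bot"
      using lim(1) by (simp add: proj_pt_scale Xnz flip: cX)
  qed (use nz PQ pq in auto)
  show thesis using that[of P Q] nz top bot PQ Xnz cX unfolding X_def by simp
qed


section \<open>Loxodromic isometries translate along their axes\<close>

text \<open>A vector in the kernel is orthogonal to everything, and the form is nondegenerate.\<close>

lemma U21_inj:
  assumes "A \<in> U21" "A *v z = 0"
  shows "z = 0"
proof -
  have h: "herm z w = 0" for w
    using assms by (simp add: U21_def) (metis herm_zero(1))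
  have "z $ i = 0" for i
    using h[of "axis i 1"] exhaust_3[of i] by (auto simp: herm_def axis_def)
  then show ?thesis by (simp add: vec_eq_iff)
qed

lemma PU21_bij:
  assumes "g \<in> PU21"
  shows "bij g"
proof -
  obtain A where A: "A \<in> U21" and g: "\<And>z. z \<noteq> 0 \<Longrightarrow> g (proj_pt z) = proj_pt (A *v z)"
    using assms by (auto simp: PU21_def)
  have Anz: "A *v z \<noteq> 0" if "z \<noteq> 0" for z using U21_inj[OF A] that by blast
  have inj: "inj ((*v) A)"
    by (rule injI) (metis A U21_inj eq_iff_diff_eq_0 matrix_vector_mult_diff_distrib)
  then obtain B where B: "B ** A = mat 1" using matrix_left_invertible_injective by blast
  then have AB: "A ** B = mat 1" using matrix_left_right_inverse by blast
  show ?thesis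
  proof (rule bijI)
    show "inj g"
    proof (rule injI)
      fix x y assume e: "g x = g y"
      obtain z w where zw: "z \<noteq> 0" "x = proj_pt z" "w \<noteq> 0" "y = proj_pt w"
        by (metis proj_pt_cases)
      then obtain k where "A *v w = k *s (A *v z)"
        using e g Anz proj_pt_eq_iff by metis
      then have "A *v w = A *v (k *s z)" by (simp add: vector_scalar_commute)
      then have "w = k *s z" using inj by (simp add: inj_eq)
      then show "x = y" using zw proj_pt_eq_iff by blast
    qed
    show "surj g"
      unfolding surj_def
    proof
      fix y
      obtain w where w: "w \<noteq> 0" "y = proj_pt w" by (metis proj_pt_cases)
      have e: "A *v (B *v w) = w" by (simp add: matrix_vector_mul_assoc AB)
      then have "B *v w \<noteq> 0" using w by auto
      then have "y = g (proj_pt (B *v w))" using g e w by simp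
      then show "\<exists>x. y = g x" by blast
    qed
  qed
qed

lemma PU21_HC2_iff:
  assumes "g \<in> PU21"
  shows "g x \<in> HC2 \<longleftrightarrow> x \<in> HC2"
proof -
  obtain A where A: "A \<in> U21" and g: "\<And>z. z \<noteq> 0 \<Longrightarrow> g (proj_pt z) = proj_pt (A *v z)"
    using assms by (auto simp: PU21_def)
  have neg: "proj_pt z \<in> HC2 \<longleftrightarrow> Re (herm z z) < 0" if z: "z \<noteq> 0" for z
  proof
    assume "proj_pt z \<in> HC2"
    then obtain y where y: "y \<noteq> 0" "Re (herm y y) < 0" "proj_pt z = proj_pt y"
      by (rule HC2_cases)
    then obtain k where k: "z = k *s y" using z proj_pt_eq_iff by metis
    with z have "k \<noteq> 0" by auto
    have "herm z z = k * cnj k * of_real (Re (herm y y))"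
      by (simp add: k mult.assoc flip: herm_self_eq)
    also have "k * cnj k = of_real ((cmod k)\<^sup>2)" by (rule complex_norm_square[symmetric])
    finally have "herm z z = of_real ((cmod k)\<^sup>2 * Re (herm y y))" by simp
    then show "Re (herm z z) < 0" using y \<open>k \<noteq> 0\<close> by (simp add: mult_pos_neg)
  qed (rule proj_pt_in_HC2)
  obtain z where z: "z \<noteq> 0" "x = proj_pt z" by (metis proj_pt_cases)
  moreover have "A *v z \<noteq> 0" using U21_inj[OF A] z by blast
  ultimately show ?thesis using A by (simp add: g neg U21_def)
qed

lemma PU21_isometry:
  assumes "g \<in> PU21"
  shows "dist_HC2 (g x) (g y) = dist_HC2 x y"
proof -
  obtain A where A: "A \<in> U21" and g: "\<And>z. z \<noteq> 0 \<Longrightarrow> g (proj_pt z) = proj_pt (A *v z)"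
    using assms by (auto simp: PU21_def)
  obtain z w where zw: "z \<noteq> 0" "x = proj_pt z" "w \<noteq> 0" "y = proj_pt w"
    by (metis proj_pt_cases)
  moreover have "A *v z \<noteq> 0" "A *v w \<noteq> 0" using U21_inj[OF A] zw by blast+
  ultimately have "herm_ratio (g x) (g y) = herm_ratio x y"
    using A by (simp add: g herm_ratio_proj_pt U21_def)
  then show ?thesis by (simp add: dist_HC2_def PU21_HC2_iff[OF assms])
qed

text \<open>The translation length comes out as \<open>l = 2 ln |m|\<close> for the eigenvalue \<open>m\<close> at
  \<open>Q\<close>. It is nonzero because a loxodromic isometry has no fixed point inside. Its sign depends
  on which of the two fixed points is attracting.\<close>

lemma loxodromic_translates_axis:
  assumes "loxodromic g" "invariant_axis g L"
  obtains c l where "range c = L" "\<And>t. c t \<in> HC2" "\<And>s t. dist_HC2 (c s) (c t) = \<bar>s - t\<bar>"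
    "l \<noteq> 0" "\<And>t. g (c t) = c (t + l)"
proof -
  have gP: "g \<in> PU21" and nofix: "\<And>x. x \<in> HC2 \<Longrightarrow> g x \<noteq> x"
    using assms(1) by (auto simp: loxodromic_def)
  obtain p q c where fixed: "{x \<in> boundary_HC2. g x = x} = {p, q}"
    and c: "range c = L" "L \<subseteq> HC2" "\<And>s t. dist_HC2 (c s) (c t) = \<bar>s - t\<bar>"
      "(c \<longlongrightarrow> p) at_bot" "(c \<longlongrightarrow> q) at_top"
    using assms(2) by (auto simp: invariant_axis_def geodesic_joining_def)
  have pq: "p \<in> boundary_HC2" "q \<in> boundary_HC2" "g p = p" "g q = q" using fixed by auto
  define X :: "complex^3 \<Rightarrow> complex^3 \<Rightarrow> real \<Rightarrow> complex^3"
    where "X P Q t = of_real (exp (t / 2)) *s Q + of_real (exp (- t / 2)) *s P" for P Q t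
  obtain P Q where PQ: "P \<noteq> 0" "Q \<noteq> 0" "p = proj_pt P" "q = proj_pt Q" "herm P Q \<noteq> 0"
    and Xnz: "\<And>t. X P Q t \<noteq> 0" and cX: "\<And>t. c t = proj_pt (X P Q t)"
    using geodesic_joining_exp_form[of c p q] c pq unfolding X_def by metis
  obtain A where A: "A \<in> U21" and g: "\<And>z. z \<noteq> 0 \<Longrightarrow> g (proj_pt z) = proj_pt (A *v z)"
    using gP by (auto simp: PU21_def)
  have eig: "\<exists>k. A *v z = k *s z" if "z \<noteq> 0" "g (proj_pt z) = proj_pt z" for z
    using that g[of z] U21_inj[OF A, of z] proj_pt_eq_iff[of z "A *v z"] by auto
  obtain m n where m: "A *v Q = m *s Q" and n: "A *v P = n *s P"
    using eig pq PQ by metis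
  have "herm (A *v P) (A *v Q) = herm P Q" using A by (simp add: U21_def)
  then have nm: "n * cnj m = 1" using PQ(5) by (simp add: m n mult.commute)
  then have m0: "m \<noteq> 0" by auto
  define r where "r = cmod m"
  have r: "r > 0" using m0 by (simp add: r_def)
  have "m * cnj m = of_real (r * r)"
    by (simp add: r_def complex_norm_square[symmetric] flip: power2_eq_square)
  then have "n * of_real (r * r) = m" using nm by (metis mult.assoc mult.commute mult.right_neutral)
  then have n_eq: "n = m / of_real (r * r)" using r by (simp add: field_simps)
  \<comment> \<open>Shifting t by l multiplies the two exponentials by r and 1/r, as A does up to the phase m/r.\<close>
  define l where "l = 2 * ln r"
  have exps: "exp ((t + l) / 2) = r * exp (t / 2)" "exp (- (t + l) / 2) = exp (- t / 2) / r" for t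
    using r by (simp_all add: l_def add_divide_distrib exp_add exp_diff diff_divide_distrib)
  have AX: "A *v X P Q t = (m / of_real r) *s X P Q (t + l)" for t
    using r unfolding X_def exps
    by (simp add: matrix_vector_right_distrib vector_scalar_commute m n n_eq
        vector_add_ldistrib vector_smult_assoc mult.commute)
  have tr: "g (c t) = c (t + l)" for t
    using r m0 by (simp add: cX g Xnz AX proj_pt_scale)
  have cH: "c t \<in> HC2" for t using c by auto
  have "l \<noteq> 0" using tr[of 0] nofix[OF cH[of 0]] by auto
  then show thesis using that[of c l] c cH tr by blast
qed


section \<open>Faces of the Dirichlet domain that meet the axis\<close>

lemma dirichlet_domain_inv:
  assumes "bij \<gamma>"
  shows "dirichlet_domain (inv \<gamma>) z = dirichlet_domain \<gamma> z"
  using assms by (simp add: dirichlet_domain_def cyclic_group_def inv_inv_eq Un_commute)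

text \<open>Except for \<open>\<gamma>\<^sup>-\<^sup>1\<close>, every nontrivial power of \<open>\<gamma>\<close> moves the parameter
  \<open>1/2\<close> to a parameter of absolute value at least \<open>3/2\<close>, hence the bounds on \<open>k\<close>. The
  power \<open>\<gamma>\<^sup>-\<^sup>1\<close> is kept apart because it gives the condition that is an equality on
  \<open>E(z, \<gamma>(z))\<close>.\<close>

lemma cyclic_group_cases:
  assumes g: "g \<in> cyclic_group \<gamma> - {id}" and "bij \<gamma>"
    and iso: "\<And>x y. rho (\<gamma> x) (\<gamma> y) = rho x y" and HH: "\<And>x. \<gamma> x \<in> HH \<longleftrightarrow> x \<in> HH"
    and tr: "\<And>t. \<gamma> (C t) = C (t + 1 :: real)"
  shows "(\<forall>x y. rho (g x) (g y) = rho x y) \<and> (\<forall>x. g x \<in> HH \<longleftrightarrow> x \<in> HH) \<and>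
    (g = inv \<gamma> \<or> (\<exists>k::real. (k \<ge> 1 \<or> k \<le> -2) \<and> (\<forall>t. g (C t) = C (t + k))))"
proof -
  let ?i = "inv \<gamma>"
  have b: "\<gamma> (?i x) = x" "?i (\<gamma> x) = x" for x
    using \<open>bij \<gamma>\<close> by (simp_all add: bij_is_surj surj_f_inv_f bij_is_inj)
  have iiso: "rho (?i x) (?i y) = rho x y" for x y
    using iso[of "?i x" "?i y"] b by simp
  have iHH: "?i x \<in> HH \<longleftrightarrow> x \<in> HH" for x
    using HH[of "?i x"] b by simp
  have itr: "?i (C t) = C (t - 1)" for t
    using tr[of "t - 1"] b(2)[of "C (t - 1)"] by simp
  have n: "rho ((\<gamma> ^^ n) x) ((\<gamma> ^^ n) y) = rho x y" "(\<gamma> ^^ n) x \<in> HH \<longleftrightarrow> x \<in> HH"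
    "(\<gamma> ^^ n) (C t) = C (t + n)" for n x y t
  proof (induction n)
    case (Suc n)
    { case 1 then show ?case using Suc iso by simp }
    { case 2 then show ?case using Suc HH by simp }
    { case 3 then show ?case using Suc tr by (simp add: add_ac) }
  qed simp_all
  have i: "rho ((?i ^^ n) x) ((?i ^^ n) y) = rho x y" "(?i ^^ n) x \<in> HH \<longleftrightarrow> x \<in> HH"
    "(?i ^^ n) (C t) = C (t - n)" for n x y t
  proof (induction n)
    case (Suc n)
    { case 1 then show ?case using Suc iiso by simp }
    { case 2 then show ?case using Suc iHH by simp }
    { case 3 then show ?case using Suc itr by (simp add: algebra_simps) }
  qed simp_all
  consider k where "g = \<gamma> ^^ k" | k where "g = ?i ^^ k"
    using g by (auto simp: cyclic_group_def)
  then show ?thesis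
  proof cases
    case 1
    then have "k \<noteq> 0" using g by (auto simp: eq_id_iff)
    then have "real k \<ge> 1" by simp
    then have "\<exists>k::real. (k \<ge> 1 \<or> k \<le> -2) \<and> (\<forall>t. g (C t) = C (t + k))"
      using 1 n(3) by blast
    moreover have "\<forall>x y. rho (g x) (g y) = rho x y" "\<forall>x. g x \<in> HH \<longleftrightarrow> x \<in> HH"
      using 1 n(1,2) by simp_all
    ultimately show ?thesis by metis
  next
    case 2
    then have "k \<noteq> 0" using g by (auto simp: eq_id_iff)
    show ?thesis
    proof (cases "k = 1")
      case True
      then show ?thesis using 2 iiso iHH by simp
    next
      case False
      then have "- real k \<le> -2" using \<open>k \<noteq> 0\<close> by simp
      moreover have "g (C t) = C (t + - real k)" for t using 2 i(3) by simp
      ultimately have "\<exists>k::real. (k \<ge> 1 \<or> k \<le> -2) \<and> (\<forall>t. g (C t) = C (t + k))"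
        by blast
      moreover have "\<forall>x y. rho (g x) (g y) = rho x y" "\<forall>x. g x \<in> HH \<longleftrightarrow> x \<in> HH"
        using 2 i(1,2) by simp_all
      ultimately show ?thesis by metis
    qed
  qed
qed

text \<open>The midpoint argument, for any isometry that translates a geodesic. The parametrization is
  scaled so that the translation is by \<open>1\<close>, which makes the speed \<open>L\<close> the translation
  length. The ball of radius \<open>L / 2\<close> about the midpoint works, since
  \<open>3 L / 2 - d \<ge> L / 2 + d\<close> for \<open>d \<le> L / 2\<close>.\<close>

lemma faces_across_axis:
  fixes C :: "real \<Rightarrow> cp2 \<times> cp2"
  assumes bij: "bij \<gamma>"
    and iso: "\<And>x y. rho (\<gamma> x) (\<gamma> y) = rho x y" and HH: "\<And>x. \<gamma> x \<in> HH \<longleftrightarrow> x \<in> HH"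
    and C: "\<And>t. C t \<in> HH" and L: "L > 0" and geo: "\<And>s t. rho (C s) (C t) = L * \<bar>s - t\<bar>"
    and tr: "\<And>t. \<gamma> (C t) = C (t + 1)"
  shows "corresponds_to_face \<gamma> (C 0) \<gamma>" and "C (1/2) \<in> face \<gamma> (C 0) \<gamma>"
    and "C (1/2) \<notin> bisector (C 0) (inv \<gamma> (C 0))"
proof -
  interpret M: Metric_space HH rho by (rule Metric_space_HH)
  have b: "\<gamma> (inv \<gamma> x) = x" "inv \<gamma> (\<gamma> x) = x" for x
    using bij by (simp_all add: bij_is_surj surj_f_inv_f bij_is_inj)
  have inv0: "inv \<gamma> (C 0) = C (-1)"
    using tr[of "-1"] b(2)[of "C (-1)"] by simp
  have C1: "\<gamma> (C 0) = C 1" using tr[of 0] by simp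
  let ?m = "C (1/2)"
  let ?T = "M.mball ?m (L / 2) \<inter> bisector (C 0) (\<gamma> (C 0))"
  have mT: "?m \<in> ?T" using C L by (simp add: bisector_def C1 geo)
  have T: "?T \<subseteq> face \<gamma> (C 0) \<gamma>"
  proof
    fix x assume x: "x \<in> ?T"
    then have xH: "x \<in> HH" and r: "rho ?m x < L / 2" and E: "rho x (C 0) = rho x (\<gamma> (C 0))"
      by (auto simp: bisector_def)
    have "rho x (C 0) \<le> rho (g x) (C 0)" if g: "g \<in> cyclic_group \<gamma> - {id}" for g
    proof -
      note cases = cyclic_group_cases[where C = C, OF g bij iso HH tr]
      then consider "g = inv \<gamma>" | k where "k \<ge> 1 \<or> k \<le> -2" "\<And>t. g (C t) = C (t + k)" by blast
      then show ?thesis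
      proof cases
        case 1
        \<comment> \<open>Here both sides are equal, because x lies on the bisector.\<close>
        then show ?thesis using iso[of "inv \<gamma> x" "C 0"] b E by simp
      next
        case 2
        have gx: "g x \<in> HH" using cases xH by blast
        have "L * (3/2) \<le> L * \<bar>1/2 + k\<bar>" using 2(1) L by (intro mult_left_mono) auto
        also have "\<dots> = rho (g ?m) (C 0)" by (simp add: 2(2) geo)
        also have "\<dots> \<le> rho (g ?m) (g x) + rho (g x) (C 0)"
          using gx C by (intro M.triangle) (simp_all add: 2(2))
        also have "rho (g ?m) (g x) = rho ?m x" using cases by blast
        finally have "rho (g x) (C 0) \<ge> L * (3/2) - rho ?m x" by simp
        moreover have "rho x (C 0) \<le> rho x ?m + rho ?m (C 0)"
          using xH C by (intro M.triangle) simp_all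
        moreover have "rho ?m (C 0) = L / 2" by (simp add: geo)
        moreover have "rho x ?m = rho ?m x" by (rule M.commute)
        ultimately show ?thesis using r by simp
      qed
    qed
    then show "x \<in> face \<gamma> (C 0) \<gamma>" using x xH by (simp add: face_def dirichlet_domain_def)
  qed
  show "?m \<in> face \<gamma> (C 0) \<gamma>" by (rule subsetD[OF T mT])
  have "openin (subtopology M.mtopology (bisector (C 0) (\<gamma> (C 0)))) ?T"
    by (rule openin_subtopology_Int) simp
  then have "?m \<in> subtopology M.mtopology (bisector (C 0) (\<gamma> (C 0))) interior_of face \<gamma> (C 0) \<gamma>"
    using subsetD[OF interior_of_maximal[OF T] mT] by blast
  moreover have "\<gamma> \<noteq> id" using C1 geo[of 0 1] geo[of 0 0] L by auto
  moreover have "\<gamma> \<in> cyclic_group \<gamma>" unfolding cyclic_group_def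
    by (intro UnI1 range_eqI[of _ _ 1]) simp
  ultimately show "corresponds_to_face \<gamma> (C 0) \<gamma>" by (auto simp: corresponds_to_face_def)
  show "?m \<notin> bisector (C 0) (inv \<gamma> (C 0))" using L by (simp add: bisector_def inv0 geo)
qed

theorem theorem1p1:
  fixes g1 g2 :: "cp2 \<Rightarrow> cp2" and L1 L2 :: "cp2 set" and z1 z2 :: cp2
    and \<gamma> :: "cp2 \<times> cp2 \<Rightarrow> cp2 \<times> cp2" and z :: "cp2 \<times> cp2"
  assumes "loxodromic g1" and "loxodromic g2"
    and "\<gamma> = map_prod g1 g2"
    and "invariant_axis g1 L1" and "invariant_axis g2 L2"
    and "z1 \<in> L1" and "z2 \<in> L2"
    and "z = (z1, z2)"
  shows "corresponds_to_face \<gamma> z \<gamma> \<and> corresponds_to_face \<gamma> z (inv \<gamma>) \<and>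
    face \<gamma> z \<gamma> \<noteq> face \<gamma> z (inv \<gamma>)"
proof -
  have P: "g1 \<in> PU21" "g2 \<in> PU21" using assms(1,2) by (auto simp: loxodromic_def)
  obtain c1 l1 where c1: "range c1 = L1" "\<And>t. c1 t \<in> HC2"
    "\<And>s t. dist_HC2 (c1 s) (c1 t) = \<bar>s - t\<bar>" "l1 \<noteq> 0" "\<And>t. g1 (c1 t) = c1 (t + l1)"
    using loxodromic_translates_axis[OF assms(1,4)] by metis
  obtain c2 l2 where c2: "range c2 = L2" "\<And>t. c2 t \<in> HC2"
    "\<And>s t. dist_HC2 (c2 s) (c2 t) = \<bar>s - t\<bar>" "l2 \<noteq> 0" "\<And>t. g2 (c2 t) = c2 (t + l2)"
    using loxodromic_translates_axis[OF assms(2,5)] by metis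
  obtain s1 s2 where s: "z1 = c1 s1" "z2 = c2 s2" using assms(6,7) c1(1) c2(1) by blast
  define C where "C t = (c1 (s1 + l1 * t), c2 (s2 + l2 * t))" for t
  define L where "L = sqrt (l1\<^sup>2 + l2\<^sup>2)"
  have L: "L > 0" using c1(4) by (simp add: L_def add_pos_nonneg)
  have z: "z = C 0" by (simp add: C_def assms(8) s)
  have CH: "C t \<in> HH" for t by (simp add: C_def c1 c2)
  have geo: "rho (C u) (C t) = L * \<bar>u - t\<bar>" for u t
  proof -
    have "rho (C u) (C t) = sqrt ((l1 * (u - t))\<^sup>2 + (l2 * (u - t))\<^sup>2)"
      by (simp add: C_def rho_eq c1 c2 right_diff_distrib)
    also have "\<dots> = sqrt ((l1\<^sup>2 + l2\<^sup>2) * (u - t)\<^sup>2)" by (simp only: power_mult_distrib distrib_right)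
    finally show ?thesis by (simp add: L_def real_sqrt_mult)
  qed
  have tr: "\<gamma> (C t) = C (t + 1)" for t by (simp add: C_def assms(3) c1 c2 algebra_simps)
  have bij: "bij \<gamma>"
    using bij_betw_map_prod[OF PU21_bij[OF P(1)] PU21_bij[OF P(2)]] assms(3) by simp
  have iso: "rho (\<gamma> x) (\<gamma> y) = rho x y" for x y
    by (cases x; cases y) (simp add: assms(3) rho_eq PU21_isometry P)
  have HH: "\<gamma> x \<in> HH \<longleftrightarrow> x \<in> HH" for x
    by (cases x) (simp add: assms(3) PU21_HC2_iff P)
  have b: "\<gamma> (inv \<gamma> x) = x" "inv \<gamma> (\<gamma> x) = x" for x
    using bij by (simp_all add: bij_is_surj surj_f_inv_f bij_is_inj)
  note fwd = faces_across_axis[OF bij iso HH CH L geo tr]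
  \<comment> \<open>The inverse translates the reversed geodesic in the positive direction.\<close>
  have "corresponds_to_face (inv \<gamma>) (C (- 0)) (inv \<gamma>)"
  proof (rule faces_across_axis[where C = "\<lambda>t. C (- t)" and L = L])
    show "bij (inv \<gamma>)" using bij by (rule bij_imp_bij_inv)
    show "rho (inv \<gamma> x) (inv \<gamma> y) = rho x y" for x y using iso[of "inv \<gamma> x" "inv \<gamma> y"] b by simp
    show "inv \<gamma> x \<in> HH \<longleftrightarrow> x \<in> HH" for x using HH[of "inv \<gamma> x"] b by simp
    show "inv \<gamma> (C (- t)) = C (- (t + 1))" for t using tr[of "- t - 1"] b(2)[of "C (- t - 1)"] by simp
  qed (use CH L geo in auto)
  then have "corresponds_to_face \<gamma> z (inv \<gamma>)"
    using bij by (simp add: z corresponds_to_face_def face_def dirichlet_domain_inv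
        cyclic_group_def inv_inv_eq Un_commute)
  moreover have "face \<gamma> z \<gamma> \<noteq> face \<gamma> z (inv \<gamma>)"
    using fwd(2,3) by (auto simp: z face_def)
  ultimately show ?thesis using fwd(1) z by blast
qed

end
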